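(* Let $\mathcal{K}$ be a complete idempotent semiring and $X$ a complete right $\mathcal{K}$-semimodule. Let $W\subset X^2$ be a complete polar cone. Assume that $s,t\in X$ are such that $(s,t)\notin W$. Then there exists $x\in X$ such that $$(f,g)\in W\implies g\backslash x\leq f\backslash x$$ and $$t\backslash x\not\leq s\backslash x.$$
   Context: An idempotent semiring $(\mathcal{K},\oplus,\otimes,\varepsilon,e)$ is ordered by the natural order $a\leq b\iff a\oplus b=b$; $\vee Q$ denotes the least upper bound of $Q$. A map $F$ between ordered sets in which every subset has a least upper bound is continuous if $F(\vee Q)=\vee F(Q)$ for all subsets $Q$. $\mathcal{K}$ is complete if every subset has a least upper bound and all left and right multiplications $b\mapsto ab$, $b\mapsto ba$ are continuous. A right $\mathcal{K}$-semimodule $X$ is a commutative monoid $(X,\oplus,\varepsilon)$ with a right action satisfying $(x\oplus z)\lambda=x\lambda\oplus z\lambda$, $x(\lambda\oplus\mu)=x\lambda\oplus x\mu$, $x(\lambda\mu)=(x\lambda)\mu$, $x\varepsilon=\varepsilon$, $\varepsilon\lambda=\varepsilon$, $xe=x$; it is then idempotent and naturally ordered by $x\le z\iff x\oplus z=z$. $X$ is complete if every subset has a least upper bound and the maps $X\to X,\ z\mapsto z\lambda$ and $\mathcal{K}\to X,\ \mu\mapsto u\mu$ are continuous for all $\lambda\in\mathcal{K}$, $u\in X$. For $u,x\in X$, $u\backslash x:=\vee\{\mu\in\mathcal{K}\mid u\mu\leq x\}$. A subsemimodule is a subset stable under all $x\lambda\oplus z\mu$; it is complete if it contains $\vee Q$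 for each of its subsets $Q$. $X^2$ carries componentwise operations. A pre-congruence is a subsemimodule $W\subset X^2$ with $(f,f)\in W$ for all $f\in X$ and $(f,g),(g,h)\in W\implies(f,h)\in W$. A polar cone is a pre-congruence $W$ such that $f\leq g\implies(f,g)\in W$. A complete polar cone is one that is complete as a subsemimodule of $X^2$. *)

theory Defs
  imports Main "HOL-Library.Product_Plus" "HOL-Library.Product_Order"
begin

(* F is continuous in the sense of complete ordered sets; Q = {} is included. *)
definition sup_preserving :: "('a::complete_lattice \<Rightarrow> 'b::complete_lattice) \<Rightarrow> bool" where
  "sup_preserving F \<longleftrightarrow> (\<forall>Q. F (Sup Q) = Sup (F ` Q))"

(* Not based on semiring_1, which would impose 0 \<noteq> 1. *)
class idem_semiring = semiring_0 + monoid_mult + order +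
  assumes add_idem: "a + a = a"
    and natural_order: "a \<le> b \<longleftrightarrow> a + b = b"

(* An order in which every subset has a least upper bound is a complete lattice; the remaining
   lattice operations are uniquely determined by the order. *)
class complete_idem_semiring = idem_semiring + complete_lattice +
  assumes mult_left_continuous: "a * Sup Q = (SUP b\<in>Q. a * b)"
    and mult_right_continuous: "Sup Q * a = (SUP b\<in>Q. b * a)"

lemma sup_preserving_mult:
  fixes a :: "'k::complete_idem_semiring"
  shows "sup_preserving (\<lambda>b. a * b)" "sup_preserving (\<lambda>b. b * a)"
  by (simp_all add: sup_preserving_def mult_left_continuous mult_right_continuous)

locale right_semimodule =
  fixes act :: "'x::comm_monoid_add \<Rightarrow> 'k::idem_semiring \<Rightarrow> 'x"
  assumes act_add_left: "act (x + z) l = act x l + act z l"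
    and act_add_right: "act x (l + m) = act x l + act x m"
    and act_mult: "act x (l * m) = act (act x l) m"
    and act_zero_right: "act x 0 = 0"
    and act_zero_left: "act 0 l = 0"
    and act_one: "act x 1 = x"

(* Idempotence of addition on 'x follows from the semimodule laws. *)
locale complete_right_semimodule = right_semimodule act
  for act :: "'x::{comm_monoid_add, complete_lattice} \<Rightarrow> 'k::complete_idem_semiring \<Rightarrow> 'x" +
  assumes module_natural_order: "(x::'x) \<le> z \<longleftrightarrow> x + z = z"
    and act_continuous_left: "sup_preserving (\<lambda>z. act z l)"
    and act_continuous_right: "sup_preserving (\<lambda>m. act u m)"

definition residual ::
  "('x::complete_lattice \<Rightarrow> 'k::complete_idem_semiring \<Rightarrow> 'x) \<Rightarrow> 'x \<Rightarrow> 'x \<Rightarrow> 'k" where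
  "residual act u x = Sup {m. act u m \<le> x}"

definition subsemimodule ::
  "('x::comm_monoid_add \<Rightarrow> 'k::idem_semiring \<Rightarrow> 'x) \<Rightarrow> 'x set \<Rightarrow> bool" where
  "subsemimodule act S \<longleftrightarrow> (\<forall>x\<in>S. \<forall>z\<in>S. \<forall>l m. act x l + act z m \<in> S)"

definition complete_subsemimodule ::
  "('x::{comm_monoid_add, complete_lattice} \<Rightarrow> 'k::idem_semiring \<Rightarrow> 'x) \<Rightarrow> 'x set \<Rightarrow> bool" where
  "complete_subsemimodule act S \<longleftrightarrow> subsemimodule act S \<and> (\<forall>Q. Q \<subseteq> S \<longrightarrow> Sup Q \<in> S)"

definition prod_act :: "('x \<Rightarrow> 'k \<Rightarrow> 'x) \<Rightarrow> 'x \<times> 'x \<Rightarrow> 'k \<Rightarrow> 'x \<times> 'x" where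
  "prod_act act p l = (act (fst p) l, act (snd p) l)"

(* The componentwise sum, order and suprema on pairs come from Product_Plus and Product_Order;
   the order is the natural one for the componentwise sum. *)
lemma complete_right_semimodule_prod:
  assumes "complete_right_semimodule act"
  shows "complete_right_semimodule (prod_act act)"
proof -
  interpret complete_right_semimodule act by fact
  have l: "act (Sup Q) l = (SUP z\<in>Q. act z l)" for Q l
    using act_continuous_left by (simp add: sup_preserving_def)
  have r: "act u (Sup Q) = (SUP m\<in>Q. act u m)" for Q u
    using act_continuous_right by (simp add: sup_preserving_def)
  show ?thesis
    by unfold_locales
      (auto simp: prod_act_def prod_eq_iff act_add_left act_add_right act_mult act_zero_left
        act_zero_right act_one less_eq_prod_def module_natural_order sup_preserving_def
        fst_Sup snd_Sup l r image_image)
qed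

definition pre_congruence ::
  "('x::comm_monoid_add \<Rightarrow> 'k::idem_semiring \<Rightarrow> 'x) \<Rightarrow> ('x \<times> 'x) set \<Rightarrow> bool" where
  "pre_congruence act W \<longleftrightarrow> subsemimodule (prod_act act) W \<and> (\<forall>f. (f, f) \<in> W) \<and>
     (\<forall>f g h. (f, g) \<in> W \<longrightarrow> (g, h) \<in> W \<longrightarrow> (f, h) \<in> W)"

definition polar_cone ::
  "('x::{comm_monoid_add, order} \<Rightarrow> 'k::idem_semiring \<Rightarrow> 'x) \<Rightarrow> ('x \<times> 'x) set \<Rightarrow> bool" where
  "polar_cone act W \<longleftrightarrow> pre_congruence act W \<and> (\<forall>f g. f \<le> g \<longrightarrow> (f, g) \<in> W)"

definition complete_polar_cone ::
  "('x::{comm_monoid_add, complete_lattice} \<Rightarrow> 'k::idem_semiring \<Rightarrow> 'x) \<Rightarrow> ('x \<times> 'x) set \<Rightarrow> bool"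
  where
  "complete_polar_cone act W \<longleftrightarrow> polar_cone act W \<and> complete_subsemimodule (prod_act act) W"

end

theory Submission
  imports Defs
begin

text \<open>
  The separating element is the largest \<open>x\<close> with \<open>(x, t) \<in> W\<close>, which exists because \<open>W\<close> is complete.
  Since \<open>W\<close> is transitive and contains the order, \<open>z \<le> x\<close> holds iff \<open>(z, t) \<in> W\<close>, so
  \<open>1 \<le> t \ x\<close> but not \<open>1 \<le> s \ x\<close>.
\<close>

lemma subsemimodule_act:
  assumes "right_semimodule act" "subsemimodule act S" "x \<in> S"
  shows "act x l \<in> S"
proof -
  interpret right_semimodule act by fact
  have "act x l + act x 0 \<in> S"
    using assms(2,3) by (auto simp: subsemimodule_def)
  then show ?thesis by (simp add: act_zero_right)
qed

context complete_right_semimodule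
begin

lemma act_mono_right:
  assumes "l \<le> m"
  shows "act u l \<le> act u m"
proof -
  have "l + m = m" using assms by (simp add: natural_order)
  then have "act u l + act u m = act u m" by (simp flip: act_add_right)
  then show ?thesis by (simp add: module_natural_order)
qed

text \<open>Continuity moves the action inside the supremum that defines the residual, so this
  supremum is itself an admissible scalar.\<close>

lemma act_residual_le: "act u (residual act u x) \<le> x"
  using act_continuous_right[of u]
  by (auto simp: residual_def sup_preserving_def intro: SUP_least)

text \<open>The Galois connection that turns bounds on residuals into inequalities in the
  semimodule.\<close>

lemma le_residual_iff: "m \<le> residual act u x \<longleftrightarrow> act u m \<le> x"
proof
  assume "m \<le> residual act u x"
  then show "act u m \<le> x"
    by (rule order_trans[OF act_mono_right act_residual_le])
next
  assume "act u m \<le> x"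
  then show "m \<le> residual act u x"
    by (simp add: residual_def Sup_upper)
qed

end

lemma complete_polar_cone_greatest:
  assumes W: "complete_polar_cone act W"
  obtains x where "\<And>z. (z, t) \<in> W \<longleftrightarrow> z \<le> x"
proof -
  have refl: "(t, t) \<in> W"
    and trans: "\<And>f g h. (f, g) \<in> W \<Longrightarrow> (g, h) \<in> W \<Longrightarrow> (f, h) \<in> W"
    and le: "\<And>f g. f \<le> g \<Longrightarrow> (f, g) \<in> W"
    and Sup: "\<And>Q. Q \<subseteq> W \<Longrightarrow> Sup Q \<in> W"
    using W
    by (simp_all add: complete_polar_cone_def polar_cone_def pre_congruence_def
        complete_subsemimodule_def)
  let ?Q = "{p \<in> W. snd p = t}"
  \<comment> \<open>Reflexivity makes the fibre \<open>?Q\<close> over \<open>t\<close> nonempty;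
    the supremum of an empty fibre would have second component \<open>bot\<close> instead of
    \<open>t\<close>.\<close>
  have "snd ` ?Q = {t}" using refl by force
  then have "Sup ?Q = (Sup (fst ` ?Q), t)"
    by (simp add: prod_eq_iff fst_Sup snd_Sup)
  moreover have "Sup ?Q \<in> W" by (rule Sup) blast
  ultimately have "(Sup (fst ` ?Q), t) \<in> W" by simp
  moreover have "z \<le> Sup (fst ` ?Q)" if "(z, t) \<in> W" for z
    using that by (intro Sup_upper) force
  ultimately have "(z, t) \<in> W \<longleftrightarrow> z \<le> Sup (fst ` ?Q)" for z
    using le[of z] trans[of z _ t] by blast
  then show thesis by (rule that)
qed

theorem theorem5:
  fixes act :: "'x::{comm_monoid_add, complete_lattice} \<Rightarrow> 'k::complete_idem_semiring \<Rightarrow> 'x"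
    and W :: "('x \<times> 'x) set"
    and s t :: 'x
  assumes "complete_right_semimodule act"
    and "complete_polar_cone act W"
    and "(s, t) \<notin> W"
  shows "\<exists>x. (\<forall>f g. (f, g) \<in> W \<longrightarrow> residual act g x \<le> residual act f x) \<and>
             \<not> residual act t x \<le> residual act s x"
proof -
  interpret complete_right_semimodule act by fact
  interpret P: complete_right_semimodule "prod_act act"
    by (rule complete_right_semimodule_prod) fact
  have sub: "subsemimodule (prod_act act) W"
    and refl: "(t, t) \<in> W"
    and trans: "\<And>f g h. (f, g) \<in> W \<Longrightarrow> (g, h) \<in> W \<Longrightarrow> (f, h) \<in> W"
    using assms(2)
    by (simp_all add: complete_polar_cone_def polar_cone_def pre_congruence_def)
  obtain x where x: "\<And>z. (z, t) \<in> W \<longleftrightarrow> z \<le> x"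
    using complete_polar_cone_greatest[OF assms(2)] by blast
  have "residual act g x \<le> residual act f x" if "(f, g) \<in> W" for f g
  proof -
    \<comment> \<open>By the Galois connection and the choice of \<open>x\<close>, the goal amounts
      to \<open>(act f ?m, t) \<in> W\<close>. Scaling \<open>(f, g)\<close> by \<open>?m\<close>
      stays in \<open>W\<close>, and transitivity through \<open>act g ?m \<le> x\<close> then
      reaches \<open>t\<close>.\<close>
    let ?m = "residual act g x"
    have "(act f ?m, act g ?m) \<in> W"
      using subsemimodule_act[OF P.right_semimodule_axioms sub that, of ?m]
      by (simp add: prod_act_def)
    moreover have "(act g ?m, t) \<in> W"
      by (simp add: x act_residual_le)
    ultimately have "(act f ?m, t) \<in> W" by (rule trans)
    then show ?thesis by (simp add: le_residual_iff x)
  qed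
  moreover have "1 \<le> residual act t x" "\<not> 1 \<le> residual act s x"
    using refl assms(3) by (simp_all add: le_residual_iff act_one x)
  ultimately show ?thesis
    by (meson order_trans)
qed

end
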